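(* Consider the normalized cut-generating conic problem $$(\mathrm{CGCP})\quad \min_{\alpha,\beta,u,\lambda,v}\ \alpha^T\bar x-\beta\quad\text{s.t.}\quad \alpha=A^Tu_h+\lambda_h+D_h^Tv_h\ \ \forall h,\quad \beta\le b^Tu_h+d_h^Tv_h\ \ \forall h,\quad (u_h,\lambda_h,v_h)\in\mathbb{R}^m\times\mathcal{K}^*\times\mathcal{Q}_h^*\ \ \forall h,\quad \sum_{h=1}^H\left(\rho^T\lambda_h+\sigma_h^Tv_h\right)\le 1,$$ and the membership conic problem $$(\mathrm{MCP})\quad \min_{y,z,\eta}\ \eta\quad\text{s.t.}\quad \sum_h y_h=\bar x,\quad \sum_h z_h=1,\quad Ay_h=z_hb\ \ \forall h,\quad D_hy_h+\eta\sigma_h-z_hd_h\in\mathcal{Q}_h\ \ \forall h,\quad (y_h+\eta\rho,z_h)\in\mathcal{K}\times\mathbb{R}_+\ \ \forall h,\quad \eta\ge 0,$$ where $h$ ranges over $\{1,\dots,H\}$, $\rho\in\operatorname{int}\mathcal{K}$ and $\sigma_h\in\operatorname{int}\mathcal{Q}_h$ for all $h$. Then both (CGCP) and (MCP) are strongly feasible.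
   Context: Setting: $A\in\mathbb{R}^{m\times n}$, $b\in\mathbb{R}^m$, $\mathcal{K}\subseteq\mathbb{R}^n$ is a proper cone (closed, convex, pointed, with non-empty interior), $H\ge 1$ is an integer, and for $h=1,\dots,H$: $D_h\in\mathbb{R}^{m_h\times n}$, $d_h\in\mathbb{R}^{m_h}$, $\mathcal{Q}_h\subseteq\mathbb{R}^{m_h}$ is a proper cone. The point $\bar x\in\mathbb{R}^n$ satisfies $A\bar x=b$ (it need not belong to $\mathcal{K}$). No assumption is made on non-emptiness or well-posedness of the sets $\{x : Ax=b,\ x\in\mathcal{K},\ D_hx-d_h\in\mathcal{Q}_h\}$. For a cone $\mathcal{C}$, the dual cone is $\mathcal{C}^*=\{u : u^Tx\ge 0\ \forall x\in\mathcal{C}\}$. Strong feasibility: a system of linear equalities and conic constraints, each cone being written as a Cartesian product of cones, is strongly feasible if it has a solution that satisfies all constraints and for which, moreover, every conic constraint corresponding to a non-polyhedral factor cone is satisfied strictly (i.e. the constrained vector lies in the interior of that factor). A problem is strongly feasible if its constraint system is. *)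

theory Defs
  imports
    "HOL-Analysis.L2_Norm"
    "HOL-Analysis.Abstract_Metric_Spaces"
    "Jordan_Normal_Form.Matrix"
begin

text \<open>
  Since the dimension of the range of the matrices varies with an index, \<open>\<real>\<^sup>k\<close> is modelled by
  \<open>carrier_vec k\<close>. This carrier has no topology of its own; it is equipped with the Euclidean one.
\<close>

definition euclid_dist :: "nat \<Rightarrow> real vec \<Rightarrow> real vec \<Rightarrow> real" where
  "euclid_dist k x y = L2_set (\<lambda>i. x $ i - y $ i) {..<k}"

definition euclid_top :: "nat \<Rightarrow> real vec topology" where
  "euclid_top k = Metric_space.mtopology (carrier_vec k) (euclid_dist k)"

lemma Metric_space_euclid: "Metric_space (carrier_vec k) (euclid_dist k)"
proof
  fix x y z :: "real vec"
  show "0 \<le> euclid_dist k x y"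
    by (simp add: euclid_dist_def)
  show "euclid_dist k x y = euclid_dist k y x"
    by (simp add: euclid_dist_def L2_set_def power2_commute)
  assume xy: "x \<in> carrier_vec k" "y \<in> carrier_vec k"
  show "euclid_dist k x y = 0 \<longleftrightarrow> x = y"
    using xy by (auto simp: euclid_dist_def L2_set_eq_0_iff intro!: eq_vecI)
  have "euclid_dist k x z =
      L2_set (\<lambda>i. (x $ i - y $ i) + (y $ i - z $ i)) {..<k}"
    by (simp add: euclid_dist_def)
  also have "\<dots> \<le> euclid_dist k x y + euclid_dist k y z"
    unfolding euclid_dist_def by (rule L2_set_triangle_ineq)
  finally show "euclid_dist k x z \<le> euclid_dist k x y + euclid_dist k y z" .
qed

definition vec_interior :: "nat \<Rightarrow> real vec set \<Rightarrow> real vec set" where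
  "vec_interior k C = euclid_top k interior_of C"

lemma vec_interior_iff:
  "x \<in> vec_interior k C \<longleftrightarrow>
    x \<in> carrier_vec k \<and> (\<exists>e>0. \<forall>y\<in>carrier_vec k. euclid_dist k x y < e \<longrightarrow> y \<in> C)"
proof -
  interpret Metric_space "carrier_vec k" "euclid_dist k"
    by (rule Metric_space_euclid)
  show ?thesis
    unfolding vec_interior_def euclid_top_def metric_interior_of by (auto simp: mball_def)
qed

definition cone_in :: "nat \<Rightarrow> real vec set \<Rightarrow> bool" where
  "cone_in k C \<longleftrightarrow> C \<subseteq> carrier_vec k \<and> (\<forall>x\<in>C. \<forall>t\<ge>0. t \<cdot>\<^sub>v x \<in> C)"

definition proper_cone :: "nat \<Rightarrow> real vec set \<Rightarrow> bool" where
  "proper_cone k C \<longleftrightarrow>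
    cone_in k C \<and>
    closedin (euclid_top k) C \<and>
    (\<forall>x\<in>C. \<forall>y\<in>C. \<forall>s\<ge>0. \<forall>t\<ge>0. s + t = 1 \<longrightarrow> s \<cdot>\<^sub>v x + t \<cdot>\<^sub>v y \<in> C) \<and>
    (\<forall>x\<in>C. - x \<in> C \<longrightarrow> x = 0\<^sub>v k) \<and>
    vec_interior k C \<noteq> {}"

definition dual_cone :: "nat \<Rightarrow> real vec set \<Rightarrow> real vec set" where
  "dual_cone k C = {u \<in> carrier_vec k. \<forall>x\<in>C. 0 \<le> u \<bullet> x}"

definition polyhedral_cone :: "nat \<Rightarrow> real vec set \<Rightarrow> bool" where
  "polyhedral_cone k C \<longleftrightarrow>
    (\<exists>r. \<exists>M \<in> carrier_mat r k. C = {x \<in> carrier_vec k. 0\<^sub>v r \<le> M *\<^sub>v x})"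

text \<open>
  A cone written as a Cartesian product is given by the list of its factors, each factor together
  with the dimension of the space it lives in.
\<close>

type_synonym factors = "(nat \<times> real vec set) list"

fun cart_prod :: "factors \<Rightarrow> real vec set" where
  "cart_prod [] = {0\<^sub>v 0}"
| "cart_prod ((k, C) # F) = {x @\<^sub>v y | x y. x \<in> C \<and> y \<in> cart_prod F}"

definition is_cone_product :: "nat \<Rightarrow> real vec set \<Rightarrow> factors \<Rightarrow> bool" where
  "is_cone_product k C F \<longleftrightarrow>
    (\<forall>(j, E) \<in> set F. cone_in j E) \<and> sum_list (map fst F) = k \<and> cart_prod F = C"

text \<open>
  The vectors of a product whose component in every non-polyhedral factor lies in the interior of
  that factor.
\<close>

definition strict_prod :: "factors \<Rightarrow> real vec set" where
  "strict_prod F =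
    cart_prod (map (\<lambda>(k, C). (k, if polyhedral_cone k C then C else vec_interior k C)) F)"

text \<open>
  Minimization problems; a pair \<open>(g, F)\<close> in \<open>conic_constraints\<close> is the constraint that
  \<open>g x\<close> belongs to the product of the factors \<open>F\<close>.
\<close>

record 'x conic_problem =
  objective :: "'x \<Rightarrow> real"
  variables :: "'x set"
  equalities :: "'x \<Rightarrow> bool"
  conic_constraints :: "(('x \<Rightarrow> real vec) \<times> factors) set"

definition feasible :: "'x conic_problem \<Rightarrow> 'x \<Rightarrow> bool" where
  "feasible P x \<longleftrightarrow>
    x \<in> variables P \<and> equalities P x \<and>
    (\<forall>(g, F) \<in> conic_constraints P. g x \<in> cart_prod F)"

definition strongly_feasible :: "'x conic_problem \<Rightarrow> bool" where
  "strongly_feasible P \<longleftrightarrow>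
    (\<exists>x. feasible P x \<and> (\<forall>(g, F) \<in> conic_constraints P. g x \<in> strict_prod F))"

text \<open>Scalar inequalities are conic constraints for the polyhedral cone \<open>\<real>\<^sub>+\<close>.\<close>

definition scalar_vec :: "real \<Rightarrow> real vec" where
  "scalar_vec t = vec 1 (\<lambda>_. t)"

definition nonneg_ray :: "nat \<times> real vec set" where
  "nonneg_ray = (1, {scalar_vec t | t. 0 \<le> t})"

text \<open>
  Here \<open>Kd\<close> and \<open>Qd h\<close> are the factors of the cones \<open>\<K>\<^sup>*\<close> and \<open>\<Q>\<^sub>h\<^sup>*\<close>,
  and the free variables \<open>u\<^sub>h\<close> contribute the factor \<open>\<real>\<^sup>m\<close>.
\<close>

definition CGCP ::
  "nat \<Rightarrow> nat \<Rightarrow> nat \<Rightarrow> (nat \<Rightarrow> nat) \<Rightarrow> real mat \<Rightarrow> real vec \<Rightarrow>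
   (nat \<Rightarrow> real mat) \<Rightarrow> (nat \<Rightarrow> real vec) \<Rightarrow> factors \<Rightarrow> (nat \<Rightarrow> factors) \<Rightarrow>
   real vec \<Rightarrow> real vec \<Rightarrow> (nat \<Rightarrow> real vec) \<Rightarrow>
   (real vec \<times> real \<times> (nat \<Rightarrow> real vec) \<times> (nat \<Rightarrow> real vec) \<times> (nat \<Rightarrow> real vec)) conic_problem"
where
  "CGCP m n H q A b D d Kd Qd xbar \<rho> \<sigma> =
    \<lparr> objective = (\<lambda>(\<alpha>, \<beta>, u, lam, v). \<alpha> \<bullet> xbar - \<beta>),
      variables = {(\<alpha>, \<beta>, u, lam, v).
        \<alpha> \<in> carrier_vec n \<and>
        (\<forall>h\<in>{1..H}. u h \<in> carrier_vec m \<and> lam h \<in> carrier_vec n \<and> v h \<in> carrier_vec (q h))},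
      equalities = (\<lambda>(\<alpha>, \<beta>, u, lam, v).
        \<forall>h\<in>{1..H}. \<alpha> = transpose_mat A *\<^sub>v u h + lam h + transpose_mat (D h) *\<^sub>v v h),
      conic_constraints =
        {(\<lambda>(\<alpha>, \<beta>, u, lam, v). scalar_vec (b \<bullet> u h + d h \<bullet> v h - \<beta>), [nonneg_ray])
          | h. h \<in> {1..H}} \<union>
        {(\<lambda>(\<alpha>, \<beta>, u, lam, v). u h @\<^sub>v lam h @\<^sub>v v h, (m, carrier_vec m) # Kd @ Qd h)
          | h. h \<in> {1..H}} \<union>
        {(\<lambda>(\<alpha>, \<beta>, u, lam, v). scalar_vec (1 - (\<Sum>h=1..H. \<rho> \<bullet> lam h + \<sigma> h \<bullet> v h)), [nonneg_ray])}
    \<rparr>"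

definition MCP ::
  "nat \<Rightarrow> nat \<Rightarrow> (nat \<Rightarrow> nat) \<Rightarrow> real mat \<Rightarrow> real vec \<Rightarrow>
   (nat \<Rightarrow> real mat) \<Rightarrow> (nat \<Rightarrow> real vec) \<Rightarrow> factors \<Rightarrow> (nat \<Rightarrow> factors) \<Rightarrow>
   real vec \<Rightarrow> real vec \<Rightarrow> (nat \<Rightarrow> real vec) \<Rightarrow>
   ((nat \<Rightarrow> real vec) \<times> (nat \<Rightarrow> real) \<times> real) conic_problem"
where
  "MCP n H q A b D d Kf Qf xbar \<rho> \<sigma> =
    \<lparr> objective = (\<lambda>(y, z, \<eta>). \<eta>),
      variables = {(y, z, \<eta>). \<forall>h\<in>{1..H}. y h \<in> carrier_vec n},
      equalities = (\<lambda>(y, z, \<eta>).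
        finsum_vec TYPE(real) n y {1..H} = xbar \<and>
        (\<Sum>h=1..H. z h) = 1 \<and>
        (\<forall>h\<in>{1..H}. A *\<^sub>v y h = z h \<cdot>\<^sub>v b)),
      conic_constraints =
        {(\<lambda>(y, z, \<eta>). D h *\<^sub>v y h + \<eta> \<cdot>\<^sub>v \<sigma> h - z h \<cdot>\<^sub>v d h, Qf h) | h. h \<in> {1..H}} \<union>
        {(\<lambda>(y, z, \<eta>). (y h + \<eta> \<cdot>\<^sub>v \<rho>) @\<^sub>v scalar_vec (z h), Kf @ [nonneg_ray])
          | h. h \<in> {1..H}} \<union>
        {(\<lambda>(y, z, \<eta>). scalar_vec \<eta>, [nonneg_ray])}
    \<rparr>"

end

theory Submission
  imports Defs "HOL-Analysis.Function_Topology" "HOL-Analysis.Abstract_Limits"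
begin

text \<open>
  For (MCP) take \<open>y\<^sub>h = x\<^sub>0 / H\<close>, where \<open>x\<^sub>0\<close> is the given point with \<open>Ax\<^sub>0 = b\<close>,
  \<open>z\<^sub>h = 1 / H\<close> and \<open>\<eta>\<close> large: since \<open>\<rho>\<close> and \<open>\<sigma>\<^sub>h\<close> are interior, a large multiple of
  them absorbs any fixed vector. For (CGCP) the same absorption argument works with interior points of
  the dual cones, which exist because the cones are closed, convex and pointed. An interior point of
  a product of cones has interior components, so the chosen points are strictly feasible for every
  factorization.
\<close>

unbundle no inner_syntax and no vec_syntax


section \<open>Coordinates, continuity and compactness in the Euclidean topology\<close>

lemma scalar_prod_sum:
  fixes x y :: "real vec"
  assumes "y \<in> carrier_vec k"
  shows "x \<bullet> y = (\<Sum>i<k. x $ i * y $ i)"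
  using assms by (simp add: scalar_prod_def atLeast0LessThan)

lemma abs_coord_le_euclid_dist:
  assumes "i < k"
  shows "\<bar>x $ i - y $ i\<bar> \<le> euclid_dist k x y"
  using member_le_L2_set[of "{..<k}" i "\<lambda>i. \<bar>x $ i - y $ i\<bar>"] assms
  by (simp add: euclid_dist_def L2_set_def)

lemma topspace_euclid_top [simp]: "topspace (euclid_top k) = carrier_vec k"
  unfolding euclid_top_def by (rule Metric_space.topspace_mtopology[OF Metric_space_euclid])

text \<open>The distance involves finitely many coordinates, each continuous on
  \<open>nat \<Rightarrow> real\<close>, so balls have open preimages. This carries compactness over
  from the product space.\<close>

lemma continuous_map_vec: "continuous_map euclidean (euclid_top k) (vec k)"
proof -
  interpret Metric_space "carrier_vec k" "euclid_dist k"
    by (rule Metric_space_euclid)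
  have "open {g. euclid_dist k (vec k f) (vec k g) < e}" for f e
  proof -
    have "euclid_dist k (vec k f) (vec k g) = sqrt (\<Sum>i<k. (f i - g i)\<^sup>2)" for g
      by (simp add: euclid_dist_def L2_set_def)
    then show ?thesis
      by (simp only:) (intro open_Collect_less continuous_intros continuous_on_product_coordinates)
  qed
  moreover have "euclid_dist k (vec k f) (vec k f) = 0" for f
    by simp
  ultimately show ?thesis
    unfolding euclid_top_def continuous_map_to_metric
    by (intro ballI allI impI, rule_tac x = "{g. euclid_dist k (vec k x) (vec k g) < \<epsilon>}" in exI) auto
qed

text \<open>Coordinates are 1-Lipschitz, so the ball of radius \<open>e\<close> is itself the
  required neighbourhood.\<close>

lemma continuous_map_coord:
  assumes "i < k"
  shows "continuous_map (euclid_top k) euclideanreal (\<lambda>x. x $ i)"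
proof -
  interpret Metric_space "carrier_vec k" "euclid_dist k"
    by (rule Metric_space_euclid)
  show ?thesis
    unfolding mtopology_is_euclidean[symmetric] Met_TC.continuous_map_to_metric
  proof (intro ballI allI impI)
    fix x :: "real vec" and e :: real
    assume x: "x \<in> topspace (euclid_top k)" and e: "0 < e"
    have "\<bar>x $ i - y $ i\<bar> < e" if "y \<in> mball x e" for y
      using abs_coord_le_euclid_dist[OF assms, of x y] that by simp
    moreover have "openin (euclid_top k) (mball x e)" "x \<in> mball x e"
      using x e by (auto simp: euclid_top_def)
    ultimately show "\<exists>U. openin (euclid_top k) U \<and> x \<in> U \<and> (\<forall>y\<in>U. y $ i \<in> Met_TC.mball (x $ i) e)"
      by (intro exI[of _ "mball x e"]) (auto simp: dist_real_def)
  qed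
qed

text \<open>The carrier condition falls on \<open>g\<close> because \<open>\<bullet>\<close> sums
  over the indices of its second argument.\<close>

lemma continuous_map_scalar_prod:
  fixes f g :: "'a \<Rightarrow> real vec"
  assumes "\<And>i. i < k \<Longrightarrow> continuous_map X euclideanreal (\<lambda>x. f x $ i)"
    and "\<And>i. i < k \<Longrightarrow> continuous_map X euclideanreal (\<lambda>x. g x $ i)"
    and "\<And>x. x \<in> topspace X \<Longrightarrow> g x \<in> carrier_vec k"
  shows "continuous_map X euclideanreal (\<lambda>x. f x \<bullet> g x)"
proof (rule continuous_map_eq)
  show "continuous_map X euclideanreal (\<lambda>x. \<Sum>i<k. f x $ i * g x $ i)"
    using assms by (intro continuous_intros) auto
qed (simp add: scalar_prod_sum[OF assms(3)])

text \<open>The box is the image under \<open>vec k\<close> of a cube in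
  \<open>nat \<Rightarrow> real\<close>, which is compact by Tychonoff's theorem.\<close>

lemma compactin_box: "compactin (euclid_top k) {x \<in> carrier_vec k. \<forall>i<k. \<bar>x $ i\<bar> \<le> r}"
proof -
  have "compactin (product_topology (\<lambda>_. euclideanreal) UNIV) (\<Pi>\<^sub>E i\<in>(UNIV::nat set). {-r..r})"
    by (simp add: compactin_PiE)
  then have "compactin euclidean (\<Pi>\<^sub>E i\<in>(UNIV::nat set). {-r..r})"
    by (simp add: euclidean_product_topology)
  from image_compactin[OF this continuous_map_vec]
  have "compactin (euclid_top k) (vec k ` (\<Pi>\<^sub>E i\<in>UNIV. {-r..r}))" .
  moreover have "vec k ` (\<Pi>\<^sub>E i\<in>UNIV. {-r..r}) = {x \<in> carrier_vec k. \<forall>i<k. \<bar>x $ i\<bar> \<le> r}"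
    if "0 \<le> r"
  proof (intro equalityI subsetI)
    fix x assume x: "x \<in> {x \<in> carrier_vec k. \<forall>i<k. \<bar>x $ i\<bar> \<le> r}"
    then show "x \<in> vec k ` (\<Pi>\<^sub>E i\<in>UNIV. {-r..r})"
      \<comment> \<open>Padding with 0 beyond \<open>k\<close> stays inside the cube because
        \<open>0 \<le> r\<close>.\<close>
      using that
      by (intro image_eqI[of _ _ "\<lambda>i. if i < k then x $ i else 0"] eq_vecI) (auto simp: abs_le_iff)
  qed (auto simp: abs_le_iff PiE_def Pi_def; smt (verit))
  \<comment> \<open>For negative \<open>r\<close> the box is empty, except in dimension 0, where it
    is a single point.\<close>
  moreover have "compactin (euclid_top k) {x \<in> carrier_vec k. \<forall>i<k. \<bar>x $ i\<bar> \<le> r}" if "r < 0"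
  proof (cases "k = 0")
    case True
    have "carrier_vec 0 = {0\<^sub>v 0 :: real vec}"
      by auto
    then show ?thesis
      using True by (auto intro!: finite_imp_compactin)
  next
    case False
    then have "{x \<in> carrier_vec k. \<forall>i<k. \<bar>x $ i\<bar> \<le> r} = ({} :: real vec set)"
      using that by (auto intro!: exI[of _ 0])
    then show ?thesis
      by (simp only: compactin_empty)
  qed
  ultimately show ?thesis
    by (cases "0 \<le> r") auto
qed

text \<open>Heine-Borel: such a set is a closed subset of a compact box.\<close>

lemma compactin_closed_bounded:
  assumes "closedin (euclid_top k) C" and "\<And>x i. x \<in> C \<Longrightarrow> i < k \<Longrightarrow> \<bar>x $ i\<bar> \<le> r"
  shows "compactin (euclid_top k) C"
  by (rule closed_compactin[OF compactin_box[of k r]])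
    (use assms closedin_subset[OF assms(1)] in auto)

text \<open>Serves twice: for the nearest point in the separation argument and for the positive
  margin on the unit sphere of a cone.\<close>

lemma compactin_attains_inf:
  fixes f :: "'a \<Rightarrow> real"
  assumes "compactin X C" "C \<noteq> {}" "continuous_map X euclideanreal f"
  shows "\<exists>x\<in>C. \<forall>y\<in>C. f x \<le> f y"
  using compact_attains_inf[of "f ` C"] image_compactin[OF assms(1,3)] assms(2)
  by auto

section \<open>Inner product and Euclidean norm\<close>

lemma scalar_prod_self_ge_0: "0 \<le> x \<bullet> (x :: real vec)"
  by (simp add: scalar_prod_def sum_nonneg)

lemma square_coord_le:
  assumes "x \<in> carrier_vec k" "i < k"
  shows "(x $ i)\<^sup>2 \<le> x \<bullet> (x :: real vec)"
  using assms member_le_sum[of i "{..<k}" "\<lambda>i. x $ i * x $ i"]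
  by (simp add: scalar_prod_sum power2_eq_square)

lemma scalar_prod_self_pos:
  assumes "x \<in> carrier_vec k" "x \<noteq> 0\<^sub>v k"
  shows "0 < x \<bullet> (x :: real vec)"
proof -
  obtain i where i: "i < k" "x $ i \<noteq> 0"
    using assms by (metis carrier_vecD dim_vec eq_vecI index_zero_vec)
  then have "0 < (x $ i)\<^sup>2"
    by simp
  then show ?thesis
    using square_coord_le[OF assms(1) i(1)] by linarith
qed

lemma Cauchy_Schwarz_vec:
  fixes x y :: "real vec"
  assumes "x \<in> carrier_vec k" "y \<in> carrier_vec k"
  shows "\<bar>x \<bullet> y\<bar> \<le> sqrt (x \<bullet> x) * sqrt (y \<bullet> y)"
proof -
  have "\<bar>x \<bullet> y\<bar> \<le> (\<Sum>i<k. \<bar>x $ i\<bar> * \<bar>y $ i\<bar>)"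
    using assms by (simp add: scalar_prod_sum abs_mult[symmetric])
  also have "\<dots> \<le> L2_set (\<lambda>i. x $ i) {..<k} * L2_set (\<lambda>i. y $ i) {..<k}"
    by (rule L2_set_mult_ineq)
  finally show ?thesis
    using assms by (simp add: L2_set_def scalar_prod_sum power2_eq_square)
qed

lemma euclid_dist_scalar_prod:
  assumes "x \<in> carrier_vec k" "y \<in> carrier_vec k"
  shows "euclid_dist k x y = sqrt ((x - y) \<bullet> (x - y))"
  using assms by (simp add: euclid_dist_def L2_set_def scalar_prod_sum[where k = k] power2_eq_square)

section \<open>Proper cones and separation of a point\<close>

lemma proper_cone_carrier: "proper_cone k C \<Longrightarrow> x \<in> C \<Longrightarrow> x \<in> carrier_vec k"
  by (auto simp: proper_cone_def cone_in_def)

lemma proper_cone_smult: "proper_cone k C \<Longrightarrow> x \<in> C \<Longrightarrow> 0 \<le> t \<Longrightarrow> t \<cdot>\<^sub>v x \<in> C"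
  by (auto simp: proper_cone_def cone_in_def)

text \<open>Convexity puts the midpoint in the cone, and doubling it gives the sum.\<close>

lemma proper_cone_add:
  assumes C: "proper_cone k C" and "x \<in> C" "y \<in> C"
  shows "x + y \<in> C"
proof -
  have "(1/2) \<cdot>\<^sub>v x + (1/2) \<cdot>\<^sub>v y \<in> C"
    using assms unfolding proper_cone_def by fastforce
  then have "2 \<cdot>\<^sub>v ((1/2) \<cdot>\<^sub>v x + (1/2) \<cdot>\<^sub>v y) \<in> C"
    by (rule proper_cone_smult[OF C]) simp
  moreover have "2 \<cdot>\<^sub>v ((1/2) \<cdot>\<^sub>v x + (1/2) \<cdot>\<^sub>v y) = x + y"
    using assms by (intro eq_vecI) (auto dest!: proper_cone_carrier[OF C])
  ultimately show ?thesis
    by simp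
qed

lemma vec_interior_subset: "vec_interior k C \<subseteq> C"
  unfolding vec_interior_def by (rule interior_of_subset)

lemma proper_cone_zero:
  assumes "proper_cone k C"
  shows "0\<^sub>v k \<in> C"
proof -
  obtain x where "x \<in> vec_interior k C"
    using assms by (auto simp: proper_cone_def)
  then have "x \<in> C"
    using vec_interior_subset by blast
  moreover have "0 \<cdot>\<^sub>v x = 0\<^sub>v k"
    using proper_cone_carrier[OF assms \<open>x \<in> C\<close>] by (intro eq_vecI) auto
  ultimately show ?thesis
    using proper_cone_smult[OF assms, of x 0] by simp
qed

text \<open>For small \<open>t\<close> the linear term dominates; this is the first-order condition
  at a minimizer.\<close>

lemma nonneg_of_small_quadratic:
  fixes a b :: real
  assumes "\<And>t. 0 < t \<Longrightarrow> t \<le> 1 \<Longrightarrow> 0 \<le> 2 * t * a + t\<^sup>2 * b"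
  shows "0 \<le> a"
proof (rule ccontr)
  assume a: "\<not> 0 \<le> a"
  \<comment> \<open>Small enough for \<open>t * \<bar>b\<bar> \<le> - a\<close>, which leaves
    \<open>2 * a + t * b \<le> a < 0\<close>.\<close>
  define t where "t = min 1 (- a / (\<bar>b\<bar> + 1))"
  have t: "0 < t" "t \<le> 1"
    using a by (auto simp: t_def field_simps)
  have "t * \<bar>b\<bar> \<le> - a"
  proof -
    have "t * (\<bar>b\<bar> + 1) \<le> - a"
      unfolding t_def by (smt (verit) min.cobounded2 pos_le_divide_eq abs_ge_zero)
    then show ?thesis
      using t by (simp add: algebra_simps)
  qed
  then have "2 * a + t * b < 0"
    using a t mult_left_mono[of b "\<bar>b\<bar>" t] by (smt (verit) abs_ge_self)
  then have "t * (2 * a + t * b) < 0"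
    using t by (simp add: mult_pos_neg)
  then show False
    using assms[OF t] by (simp add: algebra_simps power2_eq_square)
qed

text \<open>The separating vector is \<open>p - a\<close>, where \<open>p\<close> is the point of \<open>C\<close> nearest to \<open>a\<close>.\<close>

lemma proper_cone_separation:
  assumes C: "proper_cone k C" and a: "a \<in> carrier_vec k" "a \<notin> C"
  shows "\<exists>u\<in>dual_cone k C. u \<bullet> a < 0"
proof -
  note carr = proper_cone_carrier[OF C]
  define f where "f x = (x - a) \<bullet> (x - a)" for x
  have sub: "(x - a) $ i = x $ i - a $ i" if "i < k" for x i
    using a that by simp
  have fc: "continuous_map (euclid_top k) euclideanreal f"
    unfolding f_def using a
    by (intro continuous_map_scalar_prod[where k = k])
      (auto simp: sub intro!: continuous_intros continuous_map_coord)
  \<comment> \<open>With \<open>f\<close> the squared distance to \<open>a\<close>, only points of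
    \<open>C\<close> no farther from \<open>a\<close> than the origin are kept: this makes the set
    compact, and it still contains the origin.\<close>
  define B where "B = C \<inter> {x \<in> topspace (euclid_top k). f x \<in> {..f (0\<^sub>v k)}}"
  have "closedin (euclid_top k) C"
    using C by (simp add: proper_cone_def)
  then have "closedin (euclid_top k) B"
    unfolding B_def
    by (intro closedin_Int closedin_continuous_map_preimage[OF fc]) auto
  moreover have "\<bar>x $ i\<bar> \<le> sqrt (f (0\<^sub>v k)) + sqrt (a \<bullet> a)" if "x \<in> B" "i < k" for x i
  proof -
    have x: "x \<in> carrier_vec k" "f x \<le> f (0\<^sub>v k)"
      using that by (auto simp: B_def)
    have "((x - a) $ i)\<^sup>2 \<le> f (0\<^sub>v k)"
      using square_coord_le[of "x - a" k i] x a that unfolding f_def by fastforce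
    then have "\<bar>x $ i - a $ i\<bar> \<le> sqrt (f (0\<^sub>v k))"
      using that by (simp add: sub real_le_rsqrt)
    moreover have "\<bar>a $ i\<bar> \<le> sqrt (a \<bullet> a)"
      using square_coord_le[OF a(1) that(2)] by (simp add: real_le_rsqrt)
    ultimately show ?thesis
      by linarith
  qed
  ultimately have "compactin (euclid_top k) B"
    by (rule compactin_closed_bounded)
  moreover have "0\<^sub>v k \<in> B"
    using proper_cone_zero[OF C] by (simp add: B_def)
  ultimately obtain p where p: "p \<in> B" "\<And>y. y \<in> B \<Longrightarrow> f p \<le> f y"
    using compactin_attains_inf[OF _ _ fc, of B] by auto
  \<comment> \<open>Points of \<open>C\<close> outside \<open>B\<close> have \<open>f\<close> above
    \<open>f (0\<^sub>v k)\<close>, hence above \<open>f p\<close>.\<close>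
  have min: "f p \<le> f y" if "y \<in> C" for y
    using p that carr[OF that] by (cases "f y \<le> f (0\<^sub>v k)") (auto simp: B_def)
  have pC: "p \<in> C" and pc: "p \<in> carrier_vec k"
    using p carr by (auto simp: B_def)
  define u where "u = p - a"
  have uc: "u \<in> carrier_vec k"
    using pc a by (simp add: u_def)
  \<comment> \<open>Variational inequality: moving from \<open>p\<close> in a direction that stays
    in \<open>C\<close> cannot decrease \<open>f\<close>, whose derivative there is
    \<open>2 * (u \<bullet> w)\<close>.\<close>
  have dir: "0 \<le> u \<bullet> w"
    if w: "w \<in> carrier_vec k" "\<And>t. 0 < t \<Longrightarrow> t \<le> 1 \<Longrightarrow> p + t \<cdot>\<^sub>v w \<in> C" for w
  proof (rule nonneg_of_small_quadratic[of _ "w \<bullet> w"])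
    fix t :: real assume t: "0 < t" "t \<le> 1"
    have eq: "p + t \<cdot>\<^sub>v w - a = u + t \<cdot>\<^sub>v w"
      unfolding u_def using pc a w by (intro eq_vecI) auto
    have "f p \<le> f (p + t \<cdot>\<^sub>v w)"
      by (rule min[OF w(2)[OF t]])
    also have "\<dots> = u \<bullet> u + 2 * t * (u \<bullet> w) + t\<^sup>2 * (w \<bullet> w)"
      unfolding f_def eq using uc w
      by (simp add: scalar_prod_sum[where k = k] sum.distrib sum_distrib_left algebra_simps power2_eq_square)
    finally show "0 \<le> 2 * t * (u \<bullet> w) + t\<^sup>2 * (w \<bullet> w)"
      by (simp add: f_def u_def)
  qed
  \<comment> \<open>Every \<open>x \<in> C\<close> is an admissible direction, since
    \<open>C\<close> is closed under addition and scaling.\<close>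
  have "u \<in> dual_cone k C"
    using uc carr dir proper_cone_add[OF C pC] proper_cone_smult[OF C]
    by (auto simp: dual_cone_def)
  moreover have "u \<bullet> a < 0"
  proof -
    \<comment> \<open>Shrinking \<open>p\<close> towards the origin is also admissible; hence
      \<open>u \<bullet> p \<le> 0\<close>, and
      \<open>u \<bullet> a = u \<bullet> p - u \<bullet> u\<close> is negative.\<close>
    have "p + t \<cdot>\<^sub>v (- p) \<in> C" if "0 < t" "t \<le> 1" for t
    proof -
      have "p + t \<cdot>\<^sub>v (- p) = (1 - t) \<cdot>\<^sub>v p"
        by (intro eq_vecI) (auto simp: algebra_simps)
      then show ?thesis
        using proper_cone_smult[OF C pC, of "1 - t"] that by simp
    qed
    then have "0 \<le> u \<bullet> (- p)"
      by (rule dir[rotated]) (use pc in auto)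
    then have "u \<bullet> p \<le> 0"
      using uc pc by simp
    moreover have "p \<noteq> a"
      using pC a by auto
    then have "u \<noteq> 0\<^sub>v k"
      unfolding u_def using pc a
      by (metis eq_iff_diff_eq_0 carrier_vecD eq_vecI index_minus_vec(1) index_zero_vec(1))
    then have "0 < u \<bullet> u"
      by (rule scalar_prod_self_pos[OF uc])
    moreover have "u \<bullet> u = u \<bullet> p - u \<bullet> a"
      using scalar_prod_minus_distrib[OF uc pc a(1)] by (simp add: u_def)
    ultimately show ?thesis
      by linarith
  qed
  ultimately show ?thesis ..
qed

section \<open>Interior points of the dual cone\<close>

lemma dual_cone_add:
  assumes "C \<subseteq> carrier_vec k" "u \<in> dual_cone k C" "w \<in> dual_cone k C"
  shows "u + w \<in> dual_cone k C"
  using assms by (auto simp: dual_cone_def add_scalar_prod_distrib[of _ k] subset_iff)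

text \<open>The sum of the elements of \<open>F\<close> works: on \<open>C\<close> all the products
  are nonnegative, so a positive one cannot be cancelled.\<close>

lemma dual_cone_finite_sup:
  assumes C: "C \<subseteq> carrier_vec k" and "finite F" "F \<subseteq> dual_cone k C"
  shows "\<exists>w\<in>dual_cone k C. \<forall>x\<in>C. (\<exists>u\<in>F. 0 < u \<bullet> x) \<longrightarrow> 0 < w \<bullet> x"
  using assms(2,3)
proof (induction F rule: finite_induct)
  case empty
  have "0\<^sub>v k \<in> dual_cone k C"
    using C by (auto simp: dual_cone_def)
  then show ?case
    by auto
next
  case (insert u F)
  then obtain w where w: "w \<in> dual_cone k C" "\<forall>x\<in>C. (\<exists>u\<in>F. 0 < u \<bullet> x) \<longrightarrow> 0 < w \<bullet> x"
    by auto
  have u: "u \<in> dual_cone k C"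
    using insert by auto
  have "0 < (u + w) \<bullet> x" if "x \<in> C" "0 < u \<bullet> x \<or> 0 < w \<bullet> x" for x
  proof -
    have "(u + w) \<bullet> x = u \<bullet> x + w \<bullet> x"
      using u w C that by (intro add_scalar_prod_distrib[of _ k]) (auto simp: dual_cone_def)
    moreover have "0 \<le> u \<bullet> x" "0 \<le> w \<bullet> x"
      using u w that by (auto simp: dual_cone_def)
    ultimately show ?thesis
      using that by linarith
  qed
  then show ?case
    using dual_cone_add[OF C u w(1)] w(2) by (intro bexI[of _ "u + w"]) auto
qed

text \<open>
  By pointedness and separation, every nonzero \<open>x \<in> C\<close> has positive product with some
  dual vector; compactness of the unit sphere in \<open>C\<close> makes one dual vector work for all \<open>x\<close>,
  with a positive margin.
\<close>

lemma dual_cone_interior_nonempty: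
  assumes C: "proper_cone k C"
  shows "vec_interior k (dual_cone k C) \<noteq> {}"
proof -
  note carr = proper_cone_carrier[OF C]
  have Csub: "C \<subseteq> carrier_vec k"
    using carr by auto
  have cont: "continuous_map (euclid_top k) euclideanreal (\<lambda>x. u \<bullet> x)" for u
    by (intro continuous_map_scalar_prod[where k = k]) (auto intro!: continuous_map_coord)
  have cont2: "continuous_map (euclid_top k) euclideanreal (\<lambda>x. x \<bullet> x)"
    by (intro continuous_map_scalar_prod[where k = k]) (auto intro!: continuous_map_coord)
  define S where "S = C \<inter> {x \<in> topspace (euclid_top k). x \<bullet> x \<in> {1}}"
  have S: "x \<in> C" "x \<in> carrier_vec k" "x \<bullet> x = 1" if "x \<in> S" for x
    using that by (auto simp: S_def)
  have "closedin (euclid_top k) C"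
    using C by (simp add: proper_cone_def)
  then have "closedin (euclid_top k) S"
    unfolding S_def by (intro closedin_Int closedin_continuous_map_preimage[OF cont2]) auto
  moreover have "\<bar>x $ i\<bar> \<le> 1" if "x \<in> S" "i < k" for x i
    using square_coord_le[OF S(2)[OF that(1)] that(2)] S(3)[OF that(1)]
    by (simp add: abs_square_le_1)
  ultimately have comp: "compactin (euclid_top k) S"
    by (rule compactin_closed_bounded)
  define V where "V u = {x \<in> topspace (euclid_top k). u \<bullet> x \<in> {0<..}}" for u
  have "openin (euclid_top k) (V u)" for u
    unfolding V_def by (rule openin_continuous_map_preimage[OF cont]) auto
  moreover have "S \<subseteq> \<Union> (V ` dual_cone k C)"
  proof
    fix x assume x: "x \<in> S"
    have "x \<noteq> 0\<^sub>v k"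
      using S[OF x] by auto
    then have "- x \<notin> C"
      using C S(1)[OF x] by (auto simp: proper_cone_def)
    then obtain u where u: "u \<in> dual_cone k C" "u \<bullet> (- x) < 0"
      using proper_cone_separation[OF C, of "- x"] S(2)[OF x] by auto
    then have "0 < u \<bullet> x"
      using S(2)[OF x] by (auto simp: dual_cone_def)
    then show "x \<in> \<Union> (V ` dual_cone k C)"
      using u S(2)[OF x] by (auto simp: V_def)
  qed
  ultimately obtain \<F> where \<F>: "finite \<F>" "\<F> \<subseteq> V ` dual_cone k C" "S \<subseteq> \<Union> \<F>"
    using comp unfolding compactin_def by (metis (no_types, lifting) imageE)
  then obtain F where F: "F \<subseteq> dual_cone k C" "finite F" "\<F> = V ` F"
    by (meson finite_subset_image)
  then obtain w where w: "w \<in> dual_cone k C" "\<And>x. x \<in> C \<Longrightarrow> \<exists>u\<in>F. 0 < u \<bullet> x \<Longrightarrow> 0 < w \<bullet> x"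
    using dual_cone_finite_sup[OF Csub, of F] by auto
  have wc: "w \<in> carrier_vec k"
    using w by (auto simp: dual_cone_def)
  have pos: "0 < w \<bullet> x" if "x \<in> S" for x
    using \<F>(3) F(3) that S[OF that] by (intro w(2)) (auto simp: V_def)
  obtain e where e: "0 < e" "\<And>x. x \<in> S \<Longrightarrow> e \<le> w \<bullet> x"
  proof (cases "S = {}")
    \<comment> \<open>\<open>S\<close> is empty when \<open>C\<close> contains only the origin; any
      positive margin then serves.\<close>
    case True
    then show ?thesis
      using that[of 1] by simp
  next
    case False
    then show ?thesis
      using compactin_attains_inf[OF comp False cont[of w]] pos that by blast
  qed
  \<comment> \<open>The margin \<open>e\<close> is a valid radius: for \<open>x \<in> C\<close> of
    norm \<open>r\<close>, \<open>w \<bullet> x\<close> is at least \<open>e * r\<close>, and by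
    Cauchy-Schwarz replacing \<open>w\<close> by \<open>u\<close> changes the product by at most
    \<open>e * r\<close>.\<close>
  have "u \<in> dual_cone k C" if u: "u \<in> carrier_vec k" "euclid_dist k w u < e" for u
  proof -
    have "0 \<le> u \<bullet> x" if x: "x \<in> C" for x
    proof (cases "x = 0\<^sub>v k")
      case True
      then show ?thesis
        using u by simp
    next
      case False
      have xc: "x \<in> carrier_vec k"
        using carr x by simp
      define r where "r = sqrt (x \<bullet> x)"
      have r: "0 < r" "r * r = x \<bullet> x" "x \<bullet> x \<noteq> 0"
        using scalar_prod_self_pos[OF xc False] by (auto simp: r_def)
      have "((1/r) \<cdot>\<^sub>v x) \<bullet> ((1/r) \<cdot>\<^sub>v x) = (x \<bullet> x) / (r * r)"
        using xc by (simp add: field_simps)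
      then have "(1/r) \<cdot>\<^sub>v x \<in> S"
        using proper_cone_smult[OF C x, of "1/r"] r xc by (simp add: S_def)
      then have "e \<le> w \<bullet> ((1/r) \<cdot>\<^sub>v x)"
        by (rule e)
      then have "e * r \<le> w \<bullet> x"
        using r wc xc by (simp add: field_simps)
      moreover have "\<bar>(w - u) \<bullet> x\<bar> \<le> euclid_dist k w u * r"
        using Cauchy_Schwarz_vec[of "w - u" k x] wc u xc
        by (simp add: euclid_dist_scalar_prod r_def)
      moreover have "euclid_dist k w u * r \<le> e * r"
        using u r by (intro mult_right_mono) auto
      moreover have "(w - u) \<bullet> x = w \<bullet> x - u \<bullet> x"
        by (rule minus_scalar_prod_distrib[OF wc u(1) xc])
      ultimately show ?thesis
        by linarith
    qed
    then show ?thesis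
      using u by (auto simp: dual_cone_def)
  qed
  then have "w \<in> vec_interior k (dual_cone k C)"
    using wc e by (auto simp: vec_interior_iff)
  then show ?thesis
    by blast
qed

lemma cone_in_dual_cone:
  assumes "C \<subseteq> carrier_vec k"
  shows "cone_in k (dual_cone k C)"
  using assms by (auto simp: cone_in_def dual_cone_def subset_iff)

section \<open>Scaling and absorption for interior points of cones\<close>

lemma vec_interior_carrier: "x \<in> vec_interior k C \<Longrightarrow> x \<in> carrier_vec k"
  by (simp add: vec_interior_iff)

lemma euclid_dist_smult:
  assumes "0 \<le> t" "x \<in> carrier_vec k" "y \<in> carrier_vec k"
  shows "euclid_dist k (t \<cdot>\<^sub>v x) (t \<cdot>\<^sub>v y) = t * euclid_dist k x y"
proof -
  have "euclid_dist k (t \<cdot>\<^sub>v x) (t \<cdot>\<^sub>v y) = L2_set (\<lambda>i. t * (x $ i - y $ i)) {..<k}"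
    unfolding euclid_dist_def using assms
    by (intro L2_set_cong) (auto simp: algebra_simps)
  then show ?thesis
    using assms by (simp add: euclid_dist_def L2_set_right_distrib)
qed

text \<open>Pythagoras for block vectors; it allows one block to be perturbed while the other stays
  fixed.\<close>

lemma euclid_dist_append:
  assumes "x \<in> carrier_vec j" "y \<in> carrier_vec j" "x' \<in> carrier_vec l" "y' \<in> carrier_vec l"
  shows "euclid_dist (j + l) (x @\<^sub>v x') (y @\<^sub>v y') =
    sqrt ((euclid_dist j x y)\<^sup>2 + (euclid_dist l x' y')\<^sup>2)"
proof -
  have "(x @\<^sub>v x') - (y @\<^sub>v y') = (x - y) @\<^sub>v (x' - y')"
    using assms by (intro eq_vecI) auto
  then show ?thesis
    using assms
    by (simp add: euclid_dist_scalar_prod scalar_prod_append[of _ j _ l] scalar_prod_self_ge_0)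
qed

text \<open>Scaling by \<open>t\<close> turns a ball of radius \<open>e\<close> around
  \<open>x\<close> into one of radius \<open>t * e\<close> around the scaled point.\<close>

lemma vec_interior_smult:
  assumes C: "cone_in k C" and x: "x \<in> vec_interior k C" and t: "0 < t"
  shows "t \<cdot>\<^sub>v x \<in> vec_interior k C"
proof -
  obtain e where xc: "x \<in> carrier_vec k" and e: "0 < e"
    "\<And>y. y \<in> carrier_vec k \<Longrightarrow> euclid_dist k x y < e \<Longrightarrow> y \<in> C"
    using x by (auto simp: vec_interior_iff)
  have "y \<in> C" if y: "y \<in> carrier_vec k" "euclid_dist k (t \<cdot>\<^sub>v x) y < t * e" for y
  proof -
    have eq: "t \<cdot>\<^sub>v ((1/t) \<cdot>\<^sub>v y) = y"
      using t y by (intro eq_vecI) auto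
    have "t * euclid_dist k x ((1/t) \<cdot>\<^sub>v y) < t * e"
      using euclid_dist_smult[of t x k "(1/t) \<cdot>\<^sub>v y"] t xc y eq by simp
    then have "(1/t) \<cdot>\<^sub>v y \<in> C"
      using e(2) y t by simp
    then have "t \<cdot>\<^sub>v ((1/t) \<cdot>\<^sub>v y) \<in> C"
      using C t unfolding cone_in_def by (meson less_imp_le)
    then show ?thesis
      by (simp only: eq)
  qed
  then show ?thesis
    unfolding vec_interior_iff using xc t e(1) by (auto intro!: exI[of _ "t * e"])
qed

text \<open>The vector is \<open>t\<close> times \<open>x + (1/t) \<cdot>\<^sub>v w\<close>, which
  tends to \<open>x\<close>. The filter form lets finitely many such conditions be met by one
  \<open>t\<close>.\<close>

lemma vec_interior_eventually:
  assumes C: "cone_in k C" and x: "x \<in> vec_interior k C" and w: "w \<in> carrier_vec k"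
  shows "\<forall>\<^sub>F t in at_top. t \<cdot>\<^sub>v x + w \<in> vec_interior k C"
proof -
  interpret Metric_space "carrier_vec k" "euclid_dist k"
    by (rule Metric_space_euclid)
  obtain e where xc: "x \<in> carrier_vec k" and e: "0 < e"
    "\<And>y. y \<in> carrier_vec k \<Longrightarrow> euclid_dist k x y < e \<Longrightarrow> y \<in> C"
    using x by (auto simp: vec_interior_iff)
  define N where "N = euclid_dist k (0\<^sub>v k) w"
  \<comment> \<open>The threshold makes \<open>(1/t) \<cdot>\<^sub>v w\<close> shorter than
    \<open>e/2\<close>, so the ball of radius \<open>e/2\<close> around \<open>z\<close> lies in the
    ball of radius \<open>e\<close> around \<open>x\<close>.\<close>
  have "\<forall>\<^sub>F t in at_top. 0 < t \<and> 2 * N / e < t"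
    by (intro eventually_conj eventually_gt_at_top)
  then show ?thesis
  proof eventually_elim
    case (elim t)
    then have t: "0 < t" "(1/t) * N < e/2"
      using e(1) by (auto simp: field_simps)
    define z where "z = x + (1/t) \<cdot>\<^sub>v w"
    have zc: "z \<in> carrier_vec k"
      using xc w by (simp add: z_def)
    have "euclid_dist k x z = euclid_dist k ((1/t) \<cdot>\<^sub>v 0\<^sub>v k) ((1/t) \<cdot>\<^sub>v w)"
      unfolding euclid_dist_def z_def using w by (intro L2_set_cong) auto
    also have "\<dots> = (1/t) * N"
      unfolding N_def using t w by (intro euclid_dist_smult) auto
    finally have xz: "euclid_dist k x z < e/2"
      using t by simp
    have "y \<in> C" if "y \<in> carrier_vec k" "euclid_dist k z y < e/2" for y
      using e(2)[OF that(1)] triangle[OF xc zc that(1)] xz that(2) by linarith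
    then have "z \<in> vec_interior k C"
      unfolding vec_interior_iff using zc e(1) by (auto intro!: exI[of _ "e/2"])
    then have "t \<cdot>\<^sub>v z \<in> vec_interior k C"
      by (rule vec_interior_smult[OF C _ t(1)])
    moreover have "t \<cdot>\<^sub>v z = t \<cdot>\<^sub>v x + w"
      using xc w t by (intro eq_vecI) (auto simp: z_def algebra_simps)
    ultimately show ?case
      by simp
  qed
qed

section \<open>Cartesian products of cones and strict membership\<close>

lemma append_vec_assoc: "(x @\<^sub>v y) @\<^sub>v z = x @\<^sub>v (y @\<^sub>v z)"
  by (intro eq_vecI) (auto simp: append_vec_def Let_def)

lemma append_vNil [simp]: "x @\<^sub>v vNil = x"
  by (intro eq_vecI) auto

lemma cart_prod_append:
  "x \<in> cart_prod F \<Longrightarrow> y \<in> cart_prod G \<Longrightarrow> x @\<^sub>v y \<in> cart_prod (F @ G)"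
proof (induction F arbitrary: x)
  case (Cons a F)
  obtain k C where a: "a = (k, C)"
    by (cases a)
  then obtain x1 x2 where "x = x1 @\<^sub>v x2" "x1 \<in> C" "x2 @\<^sub>v y \<in> cart_prod (F @ G)"
    using Cons by auto
  then show ?case
    by (auto simp: a append_vec_assoc)
qed simp

lemma strict_prod_append:
  "x \<in> strict_prod F \<Longrightarrow> y \<in> strict_prod G \<Longrightarrow> x @\<^sub>v y \<in> strict_prod (F @ G)"
  by (simp add: strict_prod_def cart_prod_append)

lemma strict_prod_Nil [simp]: "strict_prod [] = {0\<^sub>v 0}"
  by (simp add: strict_prod_def)

lemma strict_prod_Cons [simp]:
  "strict_prod ((k, C) # F) =
    {x @\<^sub>v y | x y. x \<in> (if polyhedral_cone k C then C else vec_interior k C) \<and> y \<in> strict_prod F}"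
  by (simp add: strict_prod_def)

lemma strict_prod_subset: "strict_prod F \<subseteq> cart_prod F"
proof (induction F)
  case (Cons a F)
  obtain k C where a: "a = (k, C)"
    by (cases a)
  show ?case
    using Cons vec_interior_subset[of k C] by (auto simp: a split: if_splits)
qed simp

lemma cart_prod_carrier:
  assumes "\<forall>(j, E) \<in> set F. E \<subseteq> carrier_vec j"
  shows "cart_prod F \<subseteq> carrier_vec (sum_list (map fst F))"
  using assms by (induction F rule: cart_prod.induct) fastforce+

text \<open>Perturbing a single component keeps the whole vector in the product, so each component
  is interior to its own factor, whether polyhedral or not.\<close>

lemma vec_interior_cart_prod:
  assumes "\<forall>(j, E) \<in> set F. E \<subseteq> carrier_vec j"
    and "x \<in> vec_interior (sum_list (map fst F)) (cart_prod F)"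
  shows "x \<in> strict_prod F"
  using assms
proof (induction F arbitrary: x)
  case Nil
  then show ?case
    using vec_interior_subset[of 0 "cart_prod []"] by auto
next
  case (Cons a F)
  obtain j E where a: "a = (j, E)"
    by (cases a)
  define l where "l = sum_list (map fst F)"
  have E: "E \<subseteq> carrier_vec j"
    using Cons.prems(1) a by simp
  have F: "cart_prod F \<subseteq> carrier_vec l"
    unfolding l_def using Cons.prems(1) by (intro cart_prod_carrier) auto
  obtain e where e: "0 < e"
    "\<And>y. y \<in> carrier_vec (j + l) \<Longrightarrow> euclid_dist (j + l) x y < e \<Longrightarrow> y \<in> cart_prod (a # F)"
    using Cons.prems(2) by (auto simp: vec_interior_iff a l_def)
  have "x \<in> cart_prod (a # F)"
    using Cons.prems(2) vec_interior_subset by blast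
  then obtain x1 x2 where x: "x = x1 @\<^sub>v x2" "x1 \<in> E" "x2 \<in> cart_prod F"
    by (auto simp: a)
  have c: "x1 \<in> carrier_vec j" "x2 \<in> carrier_vec l"
    using x E F by auto
  have near: "y1 \<in> E \<and> y2 \<in> cart_prod F"
    if y: "y1 \<in> carrier_vec j" "y2 \<in> carrier_vec l"
      "sqrt ((euclid_dist j x1 y1)\<^sup>2 + (euclid_dist l x2 y2)\<^sup>2) < e" for y1 y2
  proof -
    have "y1 @\<^sub>v y2 \<in> cart_prod (a # F)"
      using y c by (intro e(2)) (auto simp: x euclid_dist_append)
    then obtain z1 z2 where z: "y1 @\<^sub>v y2 = z1 @\<^sub>v z2" "z1 \<in> E" "z2 \<in> cart_prod F"
      by (auto simp: a)
    \<comment> \<open>The first blocks have the same dimension \<open>j\<close>, so the splitting is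
      unique.\<close>
    then have "y1 = z1 \<and> y2 = z2"
      using append_vec_eq[of y1 j z1 y2 z2] y E by auto
    then show ?thesis
      using z by simp
  qed
  have zero: "euclid_dist i y y = 0" and nonneg: "0 \<le> euclid_dist i y z" for i y z
    by (auto simp: euclid_dist_def L2_set_def intro!: sum_nonneg)
  have "x1 \<in> vec_interior j E"
    unfolding vec_interior_iff using c e(1) near[of _ x2] by (auto simp: zero nonneg)
  moreover have "x2 \<in> vec_interior l (cart_prod F)"
    unfolding vec_interior_iff using c e(1) near[of x1] by (auto simp: zero nonneg)
  then have "x2 \<in> strict_prod F"
    using Cons by (simp add: l_def)
  ultimately show ?case
    using x by (auto simp: a)
qed

text \<open>Reduces strict feasibility for an arbitrary factorization to interiority in the whole
  cone.\<close>

lemma is_cone_product_strict: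
  assumes "is_cone_product k C F" "x \<in> vec_interior k C"
  shows "x \<in> strict_prod F"
  using assms vec_interior_cart_prod[of F x] by (fastforce simp: is_cone_product_def cone_in_def)

text \<open>Polyhedrality is what lets the scalar inequalities hold with equality at a strictly
  feasible point.\<close>

lemma polyhedral_nonneg_ray: "polyhedral_cone 1 {scalar_vec t | t. 0 \<le> t}"
proof -
  have "{scalar_vec t | t. 0 \<le> t} = {x \<in> carrier_vec 1. 0\<^sub>v 1 \<le> 1\<^sub>m 1 *\<^sub>v x}" (is "?L = ?R")
  proof (intro equalityI subsetI)
    fix x assume "x \<in> ?R"
    then have "x = scalar_vec (x $ 0)" "0 \<le> x $ 0"
      by (auto simp: scalar_vec_def less_eq_vec_def intro!: eq_vecI)
    then show "x \<in> ?L"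
      by blast
  qed (auto simp: scalar_vec_def less_eq_vec_def)
  then show ?thesis
    unfolding polyhedral_cone_def by (intro exI[of _ 1] bexI[of _ "1\<^sub>m 1"]) auto
qed

lemma scalar_vec_strict_prod:
  assumes "0 \<le> t"
  shows "scalar_vec t \<in> strict_prod [nonneg_ray]"
proof -
  have "scalar_vec t @\<^sub>v 0\<^sub>v 0 = scalar_vec t"
    by simp
  then show ?thesis
    unfolding nonneg_ray_def strict_prod_Cons strict_prod_Nil if_P[OF polyhedral_nonneg_ray]
    using assms by (blast intro: sym)
qed

text \<open>The whole space is its own interior, so both branches of the definition of
  \<open>strict_prod\<close> agree and polyhedrality need not be decided.\<close>

lemma strict_prod_carrier_Cons:
  assumes "u \<in> carrier_vec k" "y \<in> strict_prod F"
  shows "u @\<^sub>v y \<in> strict_prod ((k, carrier_vec k) # F)"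
proof -
  have "u \<in> vec_interior k (carrier_vec k)"
    using assms by (auto simp: vec_interior_iff intro!: exI[of _ 1])
  then show ?thesis
    using assms by auto
qed

section \<open>Strong feasibility of the two problems\<close>

lemma strongly_feasibleI:
  assumes "x \<in> variables P" "equalities P x"
    and "\<And>g F. (g, F) \<in> conic_constraints P \<Longrightarrow> g x \<in> strict_prod F"
  shows "strongly_feasible P"
  using assms strict_prod_subset unfolding strongly_feasible_def feasible_def by fast

lemma MCP_strongly_feasible:
  assumes H: "1 \<le> H"
    and A: "A \<in> carrier_mat m n"
    and K: "proper_cone n K"
    and D: "\<And>h. h \<in> {1..H} \<Longrightarrow> D h \<in> carrier_mat (q h) n"
    and d: "\<And>h. h \<in> {1..H} \<Longrightarrow> d h \<in> carrier_vec (q h)"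
    and Q: "\<And>h. h \<in> {1..H} \<Longrightarrow> proper_cone (q h) (Q h)"
    and xbar: "xbar \<in> carrier_vec n" "A *\<^sub>v xbar = b"
    and \<rho>: "\<rho> \<in> vec_interior n K"
    and \<sigma>: "\<And>h. h \<in> {1..H} \<Longrightarrow> \<sigma> h \<in> vec_interior (q h) (Q h)"
    and Kf: "is_cone_product n K Kf"
    and Qf: "\<And>h. h \<in> {1..H} \<Longrightarrow> is_cone_product (q h) (Q h) (Qf h)"
  shows "strongly_feasible (MCP n H q A b D d Kf Qf xbar \<rho> \<sigma>)"
proof -
  define y where "y = (1 / real H) \<cdot>\<^sub>v xbar"
  have y: "y \<in> carrier_vec n"
    using xbar by (simp add: y_def)
  \<comment> \<open>The part of the constraint vector for \<open>Q h\<close> that does not depend on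
    \<eta>, to be absorbed by \<open>\<sigma> h\<close>.\<close>
  define w where "w h = D h *\<^sub>v y - (1 / real H) \<cdot>\<^sub>v d h" for h
  have w: "w h \<in> carrier_vec (q h)" if "h \<in> {1..H}" for h
    unfolding w_def using D[OF that] d[OF that] y by auto
  have "\<forall>\<^sub>F \<eta> in at_top. \<forall>h\<in>{1..H}. \<eta> \<cdot>\<^sub>v \<sigma> h + w h \<in> vec_interior (q h) (Q h)"
    using Q \<sigma> w by (intro eventually_ball_finite ballI vec_interior_eventually)
      (auto simp: proper_cone_def)
  moreover have "\<forall>\<^sub>F \<eta> in at_top. \<eta> \<cdot>\<^sub>v \<rho> + y \<in> vec_interior n K"
    using K \<rho> y by (intro vec_interior_eventually) (auto simp: proper_cone_def)
  moreover have "\<forall>\<^sub>F \<eta>::real in at_top. 0 \<le> \<eta>"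
    by (rule eventually_ge_at_top)
  \<comment> \<open>There are finitely many conditions, each true for all large \<eta>, so a single
    \<eta> satisfies them all.\<close>
  ultimately have "\<forall>\<^sub>F \<eta> in at_top. (\<forall>h\<in>{1..H}. \<eta> \<cdot>\<^sub>v \<sigma> h + w h \<in> vec_interior (q h) (Q h)) \<and>
      \<eta> \<cdot>\<^sub>v \<rho> + y \<in> vec_interior n K \<and> 0 \<le> \<eta>"
    by (intro eventually_conj)
  then obtain \<eta> where
    \<eta>1: "\<And>h. h \<in> {1..H} \<Longrightarrow> \<eta> \<cdot>\<^sub>v \<sigma> h + w h \<in> vec_interior (q h) (Q h)" and
    \<eta>2: "\<eta> \<cdot>\<^sub>v \<rho> + y \<in> vec_interior n K" and \<eta>3: "0 \<le> \<eta>"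
    using eventually_happens'[OF trivial_limit_at_top_linorder] by blast
  have "D h *\<^sub>v y + \<eta> \<cdot>\<^sub>v \<sigma> h - (1 / real H) \<cdot>\<^sub>v d h \<in> strict_prod (Qf h)" if h: "h \<in> {1..H}" for h
  proof -
    have "D h *\<^sub>v y + \<eta> \<cdot>\<^sub>v \<sigma> h - (1 / real H) \<cdot>\<^sub>v d h = \<eta> \<cdot>\<^sub>v \<sigma> h + w h"
      unfolding w_def using D[OF h] d[OF h] y vec_interior_carrier[OF \<sigma>[OF h]]
      by (intro eq_vecI) auto
    then show ?thesis
      using is_cone_product_strict[OF Qf[OF h] \<eta>1[OF h]] by simp
  qed
  moreover have "(y + \<eta> \<cdot>\<^sub>v \<rho>) @\<^sub>v scalar_vec (1 / real H) \<in> strict_prod (Kf @ [nonneg_ray])"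
  proof -
    have "y + \<eta> \<cdot>\<^sub>v \<rho> = \<eta> \<cdot>\<^sub>v \<rho> + y"
      using y vec_interior_carrier[OF \<rho>] by (intro comm_add_vec[of _ n]) auto
    then show ?thesis
      using is_cone_product_strict[OF Kf \<eta>2]
      by (intro strict_prod_append scalar_vec_strict_prod) auto
  qed
  moreover have "finsum_vec TYPE(real) n (\<lambda>_. y) {1..H} = xbar"
  proof (rule eq_vecI)
    have c: "(\<lambda>_. y) \<in> {1..H} \<rightarrow> carrier_vec n"
      using y by simp
    show "dim_vec (finsum_vec TYPE(real) n (\<lambda>_. y) {1..H}) = dim_vec xbar"
      using finsum_vec_closed[OF c] xbar by simp
    fix i assume "i < dim_vec xbar"
    then show "finsum_vec TYPE(real) n (\<lambda>_. y) {1..H} $ i = xbar $ i"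
      using xbar H index_finsum_vec[OF _ _ c, of i] by (simp add: y_def)
  qed
  moreover have "A *\<^sub>v y = (1 / real H) \<cdot>\<^sub>v b"
    unfolding y_def using mult_mat_vec[OF A xbar(1)] xbar(2) by simp
  ultimately show ?thesis
    using y H \<eta>3
    by (intro strongly_feasibleI[of "(\<lambda>_. y, \<lambda>_. 1 / real H, \<eta>)"])
      (auto simp: MCP_def intro: scalar_vec_strict_prod)
qed

text \<open>
  With \<open>u = 0\<close> and interior points \<open>v\<^sub>h\<close> of the cones \<open>\<Q>\<^sub>h\<^sup>*\<close>, choose \<open>\<alpha> = t\<lambda>\<close>
  with \<open>\<lambda>\<close> interior to \<open>\<K>\<^sup>*\<close> and \<open>t\<close> so large that \<open>\<lambda>\<^sub>h = \<alpha> - D\<^sub>h\<^sup>Tv\<^sub>h\<close> is interior for every \<open>h\<close>;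
  scaling by \<open>s\<close> then meets the normalization.
\<close>

lemma CGCP_strongly_feasible:
  assumes H: "1 \<le> H"
    and A: "A \<in> carrier_mat m n"
    and b: "b \<in> carrier_vec m"
    and K: "proper_cone n K"
    and D: "\<And>h. h \<in> {1..H} \<Longrightarrow> D h \<in> carrier_mat (q h) n"
    and Q: "\<And>h. h \<in> {1..H} \<Longrightarrow> proper_cone (q h) (Q h)"
    and \<rho>: "\<rho> \<in> carrier_vec n"
    and \<sigma>: "\<And>h. h \<in> {1..H} \<Longrightarrow> \<sigma> h \<in> carrier_vec (q h)"
    and Kd: "is_cone_product n (dual_cone n K) Kd"
    and Qd: "\<And>h. h \<in> {1..H} \<Longrightarrow> is_cone_product (q h) (dual_cone (q h) (Q h)) (Qd h)"
  shows "strongly_feasible (CGCP m n H q A b D d Kd Qd xbar \<rho> \<sigma>)"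
proof -
  have coneK: "cone_in n (dual_cone n K)"
    using proper_cone_carrier[OF K] by (auto intro: cone_in_dual_cone)
  have coneQ: "cone_in (q h) (dual_cone (q h) (Q h))" if "h \<in> {1..H}" for h
    using proper_cone_carrier[OF Q[OF that]] by (auto intro: cone_in_dual_cone)
  obtain l where l: "l \<in> vec_interior n (dual_cone n K)"
    using dual_cone_interior_nonempty[OF K] by auto
  have "\<forall>h\<in>{1..H}. \<exists>v. v \<in> vec_interior (q h) (dual_cone (q h) (Q h))"
    using dual_cone_interior_nonempty[OF Q] by blast
  then obtain v where v: "\<And>h. h \<in> {1..H} \<Longrightarrow> v h \<in> vec_interior (q h) (dual_cone (q h) (Q h))"
    by (metis (no_types))
  note lc = vec_interior_carrier[OF l] and vc = vec_interior_carrier[OF v]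
  define w where "w h = - (transpose_mat (D h) *\<^sub>v v h)" for h
  have w: "w h \<in> carrier_vec n" if "h \<in> {1..H}" for h
    unfolding w_def using D[OF that] vc[OF that] by (auto intro!: mult_mat_vec_carrier)
  have "\<forall>\<^sub>F t in at_top. \<forall>h\<in>{1..H}. t \<cdot>\<^sub>v l + w h \<in> vec_interior n (dual_cone n K)"
    using coneK l w by (intro eventually_ball_finite ballI vec_interior_eventually) auto
  then obtain t where t: "\<And>h. h \<in> {1..H} \<Longrightarrow> t \<cdot>\<^sub>v l + w h \<in> vec_interior n (dual_cone n K)"
    using eventually_happens'[OF trivial_limit_at_top_linorder] by blast
  define S where "S = (\<Sum>h=1..H. \<rho> \<bullet> (t \<cdot>\<^sub>v l + w h) + \<sigma> h \<bullet> v h)"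
  \<comment> \<open>This denominator is positive and exceeds \<open>S\<close>, whatever the sign of
    \<open>S\<close>.\<close>
  define s where "s = 1 / (1 + \<bar>S\<bar>)"
  have s: "0 < s" "s * S \<le> 1"
    by (auto simp: s_def field_simps abs_if add_pos_nonneg)
  define lam where "lam h = s \<cdot>\<^sub>v (t \<cdot>\<^sub>v l + w h)" for h
  define v' where "v' h = s \<cdot>\<^sub>v v h" for h
  \<comment> \<open>The largest value that all the bounds admit when \<open>u = 0\<close>; the
    inequality is tight at a minimizing \<open>h\<close>.\<close>
  define \<beta> where "\<beta> = Min ((\<lambda>h. d h \<bullet> v' h) ` {1..H})"
  have lam: "lam h \<in> vec_interior n (dual_cone n K)" if "h \<in> {1..H}" for h
    unfolding lam_def by (rule vec_interior_smult[OF coneK t[OF that] s(1)])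
  have v': "v' h \<in> vec_interior (q h) (dual_cone (q h) (Q h))" if "h \<in> {1..H}" for h
    unfolding v'_def by (rule vec_interior_smult[OF coneQ[OF that] v[OF that] s(1)])
  \<comment> \<open>The left side is the common \<alpha>, the same for every \<open>h\<close>: the
    term \<open>s \<cdot>\<^sub>v w h\<close> inside \<open>lam h\<close> cancels the contribution
    of \<open>v' h\<close>.\<close>
  have eq: "(s * t) \<cdot>\<^sub>v l = transpose_mat A *\<^sub>v 0\<^sub>v m + lam h + transpose_mat (D h) *\<^sub>v v' h"
    if h: "h \<in> {1..H}" for h
  proof -
    have 1: "transpose_mat (D h) *\<^sub>v v' h = s \<cdot>\<^sub>v (transpose_mat (D h) *\<^sub>v v h)"
      unfolding v'_def using D[OF h] vc[OF h] by (intro mult_mat_vec) auto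
    have 2: "transpose_mat A *\<^sub>v 0\<^sub>v m = 0\<^sub>v n"
      using A by (intro eq_vecI) auto
    show ?thesis
      unfolding 1 2 lam_def w_def using D[OF h] lc
      by (intro eq_vecI) (auto simp: algebra_simps)
  qed
  have \<beta>: "scalar_vec (b \<bullet> 0\<^sub>v m + d h \<bullet> v' h - \<beta>) \<in> strict_prod [nonneg_ray]"
    if "h \<in> {1..H}" for h
  proof -
    have "\<beta> \<le> d h \<bullet> v' h"
      unfolding \<beta>_def using that by (intro Min_le) auto
    then show ?thesis
      using b by (intro scalar_vec_strict_prod) simp
  qed
  have \<sigma>v: "\<sigma> h \<bullet> (s \<cdot>\<^sub>v v h) = s * (\<sigma> h \<bullet> v h)" if "h \<in> {1..H}" for h
    by (rule scalar_prod_smult_distrib[OF \<sigma>[OF that] vc[OF that]])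
  have "(\<Sum>h=1..H. \<rho> \<bullet> lam h + \<sigma> h \<bullet> v' h) = s * S"
    unfolding S_def sum_distrib_left lam_def v'_def
    using \<rho> lc w
    by (intro sum.cong refl) (simp add: \<sigma>v scalar_prod_smult_distrib[of _ n] algebra_simps)
  then have norm: "scalar_vec (1 - (\<Sum>h=1..H. \<rho> \<bullet> lam h + \<sigma> h \<bullet> v' h)) \<in> strict_prod [nonneg_ray]"
    using s by (intro scalar_vec_strict_prod) simp
  have "0\<^sub>v m @\<^sub>v lam h @\<^sub>v v' h \<in> strict_prod ((m, carrier_vec m) # Kd @ Qd h)"
    if h: "h \<in> {1..H}" for h
    by (intro strict_prod_carrier_Cons strict_prod_append is_cone_product_strict[OF Kd lam[OF h]]
        is_cone_product_strict[OF Qd[OF h] v'[OF h]]) simp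
  then show ?thesis
    using eq \<beta> norm lc vec_interior_carrier[OF lam] vec_interior_carrier[OF v']
    by (intro strongly_feasibleI[of "((s * t) \<cdot>\<^sub>v l, \<beta>, \<lambda>_. 0\<^sub>v m, lam, v')"])
      (auto simp: CGCP_def)
qed

theorem theorem8:
  fixes m n H :: nat and q :: "nat \<Rightarrow> nat"
    and A :: "real mat" and b xbar \<rho> :: "real vec"
    and D :: "nat \<Rightarrow> real mat" and d \<sigma> :: "nat \<Rightarrow> real vec"
    and K :: "real vec set" and Q :: "nat \<Rightarrow> real vec set"
    and Kf Kd :: factors and Qf Qd :: "nat \<Rightarrow> factors"
  assumes "1 \<le> H"
    and "A \<in> carrier_mat m n"
    and "b \<in> carrier_vec m"
    and "proper_cone n K"
    and "\<And>h. h \<in> {1..H} \<Longrightarrow> D h \<in> carrier_mat (q h) n"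
    and "\<And>h. h \<in> {1..H} \<Longrightarrow> d h \<in> carrier_vec (q h)"
    and "\<And>h. h \<in> {1..H} \<Longrightarrow> proper_cone (q h) (Q h)"
    and "xbar \<in> carrier_vec n"
    and "A *\<^sub>v xbar = b"
    and "\<rho> \<in> vec_interior n K"
    and "\<And>h. h \<in> {1..H} \<Longrightarrow> \<sigma> h \<in> vec_interior (q h) (Q h)"
    and "is_cone_product n K Kf"
    and "is_cone_product n (dual_cone n K) Kd"
    and "\<And>h. h \<in> {1..H} \<Longrightarrow> is_cone_product (q h) (Q h) (Qf h)"
    and "\<And>h. h \<in> {1..H} \<Longrightarrow> is_cone_product (q h) (dual_cone (q h) (Q h)) (Qd h)"
  shows "strongly_feasible (CGCP m n H q A b D d Kd Qd xbar \<rho> \<sigma>) \<and>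
         strongly_feasible (MCP n H q A b D d Kf Qf xbar \<rho> \<sigma>)"
proof
  show "strongly_feasible (CGCP m n H q A b D d Kd Qd xbar \<rho> \<sigma>)"
    using assms vec_interior_carrier[OF assms(10)] vec_interior_carrier[OF assms(11)]
    by (intro CGCP_strongly_feasible[where K = K and Q = Q])
  show "strongly_feasible (MCP n H q A b D d Kf Qf xbar \<rho> \<sigma>)"
    using assms by (intro MCP_strongly_feasible[where K = K and Q = Q])
qed

end
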